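(* Let $m\in\mathbb{N}$ and let $j,p$ be integers with $0\le j,p \le m$. Then $$K_{2j}^{2m}(p) = \frac{\binom{2m}{2j}}{\binom{2m}{p} \binom{m}{j}} \sum_{\substack{0\le \ell\le p \\ \ell \equiv p \pmod 2}} 2^\ell \, \binom{m-\ell}{\frac{p-\ell}{2}} \binom{m}{\ell}\; K_j^{m}(\ell).$$
   Context: $\mathbb{N}=\{1,2,\dots\}$. For $x$ any number and $i\in\mathbb{N}_0$, $\binom{x}{i} = x(x-1)\cdots(x-i+1)/i!$ for $i\ge 1$ and $\binom{x}{0}=1$. For $0\le p\le n$ the binary Krawtchouk polynomial of order $n$ and degree $p$ is $$K_p^n(x) = \sum_{i=0}^p (-1)^i \binom{x}{i}\binom{n-x}{p-i}.$$ *)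

theory Defs
  imports Complex_Main
begin

text \<open>
  The Krawtchouk polynomial of order \<open>n\<close> and degree \<open>p\<close>, as a function of its
  argument; it is meant for \<open>p \<le> n\<close>. Both binomials are generalized ones, because \<open>x\<close> is an
  arbitrary number; in particular \<open>of_nat n - x\<close> is a subtraction in the field.
\<close>

definition krawtchouk :: "nat \<Rightarrow> nat \<Rightarrow> 'a::field_char_0 \<Rightarrow> 'a" where
  "krawtchouk n p x =
     (\<Sum>i=0..p. (- 1) ^ i * (x gchoose i) * ((of_nat n - x) gchoose (p - i)))"

end

theory Submission
  imports Defs "HOL-Computational_Algebra.Polynomial"
begin

text \<open>
  The symmetry \<open>(n choose x) K_p^n(x) = (n choose p) K_x^n(p)\<close>, applied on both sides, reduces the
  claim to an expansion of \<open>K_p^{2m}(2j)\<close>. This is the coefficient of \<open>z^p\<close> in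
  \<open>(1 - z)^{2j} (1 + z)^{2m - 2j} = ((1 + z^2) - 2z)^j ((1 + z^2) + 2z)^{m - j}\<close>, and the
  homogeneous generating function of \<open>K_l^m(j)\<close> expands the right-hand side in the products
  \<open>(2z)^l (1 + z^2)^{m - l}\<close>.
\<close>

lemma krawtchouk_of_nat:
  assumes "x \<le> n"
  shows "krawtchouk n p (of_nat x) =
    (\<Sum>i\<le>p. (- 1) ^ i * of_nat (x choose i) * of_nat ((n - x) choose (p - i)))"
  using assms
  by (simp add: krawtchouk_def binomial_gbinomial atMost_atLeast0)

text \<open>Both sides count the pairs of subsets of an \<open>n\<close>-set with sizes
  \<open>x\<close> and \<open>p\<close> and intersection of size \<open>i\<close>, choosing one or
  the other subset first.\<close>

lemma binomial_subset_mult_swap: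
  assumes "x \<le> n" "p \<le> n" "i \<le> p" "i \<le> x"
  shows "(n choose x) * (x choose i) * ((n - x) choose (p - i)) =
    (n choose p) * (p choose i) * ((n - p) choose (x - i))"
\<comment> \<open>The union of the two subsets, of size \<open>x + p - i\<close>, has to fit into
  the \<open>n\<close>-set. If it does, no subtraction truncates and factorials give the claim;
  otherwise both sides vanish.\<close>
proof (cases "x + p \<le> n + i")
  case True
  have eq: "n - x - (p - i) = n - p - (x - i)" using assms True by simp
  have "real ((n choose x) * (x choose i) * ((n - x) choose (p - i))) =
      real ((n choose p) * (p choose i) * ((n - p) choose (x - i)))"
    using assms True by (simp add: binomial_fact eq add.commute[of x p])
  then show ?thesis by linarith
next
  case False
  then have "n - x < p - i" "n - p < x - i" using assms by linarith+
  then show ?thesis by (simp add: binomial_eq_0)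
qed

lemma krawtchouk_symmetry:
  assumes "x \<le> n" "p \<le> n"
  shows "of_nat (n choose x) * krawtchouk n p (of_nat x) =
    (of_nat (n choose p) * krawtchouk n x (of_nat p) :: 'a::field_char_0)"
proof -
  \<comment> \<open>Terms with \<open>i > y\<close> vanish. Cutting them off makes the index range
    symmetric, so that the swap applies term by term.\<close>
  have restrict: "krawtchouk n q (of_nat y) =
      (\<Sum>i\<le>min q y. (- 1) ^ i * of_nat (y choose i) * of_nat ((n - y) choose (q - i)) :: 'a)"
    if "y \<le> n" for q y
    unfolding krawtchouk_of_nat[OF that]
    by (rule sum.mono_neutral_right) auto
  have "(of_nat (n choose x) * krawtchouk n p (of_nat x) :: 'a) = (\<Sum>i\<le>min p x. (- 1) ^ i *
      of_nat ((n choose x) * (x choose i) * ((n - x) choose (p - i))))"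
    by (simp add: restrict assms sum_distrib_left mult_ac)
  also have "\<dots> = (\<Sum>i\<le>min x p. (- 1) ^ i *
      of_nat ((n choose p) * (p choose i) * ((n - p) choose (x - i))))"
    by (rule sum.cong) (simp_all add: binomial_subset_mult_swap assms min.commute
        del: of_nat_mult)
  also have "\<dots> = of_nat (n choose p) * krawtchouk n x (of_nat p)"
    by (simp add: restrict assms sum_distrib_left mult_ac)
  finally show ?thesis .
qed

lemma degree_linear_power_le:
  fixes a c :: "'a::comm_ring_1"
  shows "degree ([:a, c:] ^ k) \<le> k"
  using degree_power_le[of "[:a, c:]" k] by (simp split: if_splits)

text \<open>Both sides are zero for \<open>i > k\<close>; including this case lets the formula be
  used at every index of the Cauchy product.\<close>

lemma coeff_linear_power:
  fixes a c :: "'a::comm_ring_1"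
  shows "coeff ([:a, c:] ^ k) i = of_nat (k choose i) * c ^ i * a ^ (k - i)"
proof (cases "i \<le> k")
  case True
  then show ?thesis by (rule coeff_linear_poly_power)
next
  case False
  then have "degree ([:a, c:] ^ k) < i"
    using degree_linear_power_le[of a c k] by linarith
  then show ?thesis
    using False by (simp add: coeff_eq_0 binomial_eq_0)
qed

text \<open>By homogeneity all nonzero terms of the Cauchy product share the factor
  \<open>b ^ p * a ^ (n - p)\<close>. The sum is written out because \<open>krawtchouk\<close> needs
  a field, whereas \<open>a\<close> and \<open>b\<close> will later be polynomials.\<close>

lemma coeff_linear_power_mult_linear_power:
  fixes a b :: "'a::comm_ring_1"
  assumes "x \<le> n"
  shows "coeff ([:a, - b:] ^ x * [:a, b:] ^ (n - x)) p =
    (\<Sum>i\<le>p. (- 1) ^ i * of_nat (x choose i) * of_nat ((n - x) choose (p - i)))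
      * b ^ p * a ^ (n - p)"
proof -
  have "of_nat (x choose i) * (- b) ^ i * a ^ (x - i) *
      (of_nat ((n - x) choose (p - i)) * b ^ (p - i) * a ^ (n - x - (p - i))) =
    (- 1) ^ i * of_nat (x choose i) * of_nat ((n - x) choose (p - i)) * b ^ p * a ^ (n - p)"
    if "i \<le> p" for i
  \<comment> \<open>Here the exponents of \<open>a\<close> add up without truncation; in the other
    case a binomial coefficient is zero.\<close>
  proof (cases "i \<le> x \<and> p - i \<le> n - x")
    case True
    have "a ^ (n - p) = a ^ (x - i) * a ^ (n - x - (p - i))"
      unfolding power_add[symmetric] using True that assms
      by (intro arg_cong[of _ _ "(^) a"]) linarith
    moreover have "b ^ p = b ^ i * b ^ (p - i)"
      using that by (simp flip: power_add)
    moreover have "(- b) ^ i = (- 1) ^ i * b ^ i"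
      by (rule power_minus)
    ultimately show ?thesis by (simp add: mult_ac)
  next
    case False
    then have "x choose i = 0 \<or> (n - x) choose (p - i) = 0" by auto
    then show ?thesis by (metis mult_zero_left mult_zero_right of_nat_0)
  qed
  then show ?thesis
    by (simp add: coeff_mult coeff_linear_power sum_distrib_right)
qed

text \<open>An auxiliary variable marks each factor \<open>b\<close>; it is set to \<open>1\<close> at the end.\<close>

lemma krawtchouk_homogeneous_generating_function:
  fixes a b :: "'a::comm_ring_1"
  assumes "x \<le> n"
  shows "(a - b) ^ x * (a + b) ^ (n - x) =
    (\<Sum>l\<le>n. (\<Sum>i\<le>l. (- 1) ^ i * of_nat (x choose i) * of_nat ((n - x) choose (l - i)))
      * b ^ l * a ^ (n - l))"
proof -
  let ?P = "[:a, - b:] ^ x * [:a, b:] ^ (n - x)"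
  have "degree ?P \<le> x + (n - x)"
    by (meson add_mono degree_linear_power_le degree_mult_le order_trans)
  then have deg: "degree ?P \<le> n" using assms by simp
  have "poly ?P 1 = (\<Sum>l\<le>n. coeff ?P l)"
    by (subst poly_as_sum_of_monoms'[OF deg, symmetric]) (simp add: poly_sum poly_monom)
  then show ?thesis
    by (simp add: coeff_linear_power_mult_linear_power[OF assms] del: One_nat_def)
qed

text \<open>This is the source of the parity condition on \<open>l\<close> and of the binomial
  coefficient with lower entry \<open>(p - l) div 2\<close>.\<close>

lemma coeff_one_plus_square_power:
  "coeff ((1 + monom 1 2 :: 'a::comm_ring_1 poly) ^ k) r =
    (if even r then of_nat (k choose (r div 2)) else 0)"
proof -
  have "(1 + monom 1 2 :: 'a poly) ^ k = (\<Sum>i\<le>k. of_nat (k choose i) * monom 1 (2 * i))"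
    by (simp add: add.commute[of 1] binomial_ring monom_power)
  then have "coeff ((1 + monom 1 2 :: 'a poly) ^ k) r =
      (\<Sum>i\<le>k. if r = 2 * i then of_nat (k choose i) else 0)"
    by (simp add: coeff_sum of_nat_poly eq_commute if_distrib cong: if_cong)
  also have "\<dots> = (if even r then of_nat (k choose (r div 2)) else 0)"
  proof (cases "even r")
    case True
    then obtain s where "r = 2 * s" by blast
    then show ?thesis by (auto simp: binomial_eq_0)
  next
    case False
    then have "r \<noteq> 2 * i" for i by auto
    with False show ?thesis by simp
  qed
  finally show ?thesis .
qed

lemma krawtchouk_even:
  assumes "j \<le> m" "p \<le> m"
  shows "krawtchouk (2 * m) p (of_nat (2 * j) :: 'a::field_char_0) =
    (\<Sum>l | l \<le> p \<and> l mod 2 = p mod 2.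
      2 ^ l * of_nat ((m - l) choose ((p - l) div 2)) * krawtchouk m l (of_nat j))"
proof -
  let ?a = "1 + monom 1 2 :: 'a poly" and ?b = "monom 2 1 :: 'a poly"
  \<comment> \<open>With \<open>?a\<close> as 1 + z^2 and \<open>?b\<close> as 2z, even powers of 1
    - z and 1 + z become powers of \<open>?a - ?b\<close> and \<open>?a + ?b\<close>.\<close>
  have sq: "[:1, - 1:] ^ 2 = ?a - ?b" "[:1, 1:] ^ 2 = ?a + ?b"
    by (simp_all add: power2_eq_square monom_altdef one_pCons numeral_2_eq_2)
  have sum_const: "(\<Sum>i\<in>A. [:f i:]) = [:\<Sum>i\<in>A. f i:]"
    for A :: "nat set" and f :: "nat \<Rightarrow> 'a"
    by (induction A rule: infinite_finite_induct) auto
  have neg_one: "(- 1) ^ i = [:(- 1) ^ i :: 'a:]" for i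
    using poly_const_pow[of "- 1 :: 'a" i] by (simp add: one_pCons)
  \<comment> \<open>The generating function is used over the polynomial ring, where its inner sums
    are constant polynomials.\<close>
  have const: "(\<Sum>i\<le>l. (- 1) ^ i * of_nat (j choose i) * of_nat ((m - j) choose (l - i))) =
      [:krawtchouk m l (of_nat j) :: 'a:]" for l
    by (simp add: krawtchouk_of_nat[OF assms(1)] of_nat_poly neg_one sum_const mult_ac)
  have "krawtchouk (2 * m) p (of_nat (2 * j) :: 'a) =
      coeff ([:1, - 1:] ^ (2 * j) * [:1, 1:] ^ (2 * m - 2 * j)) p"
    using assms
    by (subst coeff_linear_power_mult_linear_power)
      (auto simp del: of_nat_mult simp add: krawtchouk_of_nat)
  also have "[:1, - 1:] ^ (2 * j) * [:1, 1:] ^ (2 * m - 2 * j) = (?a - ?b) ^ j * (?a + ?b) ^ (m - j)"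
    unfolding sq[symmetric] power_mult[symmetric] by (simp add: algebra_simps)
  also have "\<dots> = (\<Sum>l\<le>m. [:krawtchouk m l (of_nat j):] * ?b ^ l * ?a ^ (m - l))"
    by (simp only: krawtchouk_homogeneous_generating_function[OF assms(1)] const)
  also have "\<dots> = (\<Sum>l\<le>m. smult (krawtchouk m l (of_nat j)) (monom (2 ^ l) l * ?a ^ (m - l)))"
    by (simp add: monom_power)
  also have "coeff \<dots> p = (\<Sum>l\<le>m. krawtchouk m l (of_nat j) *
      (if p < l then 0 else 2 ^ l * coeff (?a ^ (m - l)) (p - l)))"
    by (simp add: coeff_sum coeff_monom_mult)
  also have "\<dots> = (\<Sum>l | l \<le> p \<and> l mod 2 = p mod 2.
      2 ^ l * of_nat ((m - l) choose ((p - l) div 2)) * krawtchouk m l (of_nat j))"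
    \<comment> \<open>The terms dropped have \<open>l > p\<close> or odd \<open>p - l\<close>;
      \<open>p \<le> m\<close> keeps all the others within the range up to \<open>m\<close>.\<close>
    using assms
    by (intro sum.mono_neutral_cong_right)
      (auto simp: coeff_one_plus_square_power mod2_eq_if split: if_splits)
  finally show ?thesis .
qed

theorem corollary2p4:
  fixes m j p :: nat
  assumes "m \<ge> 1" and "j \<le> m" and "p \<le> m"
  shows "krawtchouk (2 * m) (2 * j) (real p) =
    real (2 * m choose (2 * j)) / (real (2 * m choose p) * real (m choose j)) *
    (\<Sum>l | l \<le> p \<and> l mod 2 = p mod 2.
       2 ^ l * real ((m - l) choose ((p - l) div 2)) * real (m choose l) *
       krawtchouk m j (real l))"
proof -
  have outer: "real (2 * m choose p) * krawtchouk (2 * m) (2 * j) (real p) =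
      real (2 * m choose (2 * j)) * krawtchouk (2 * m) p (real (2 * j))"
    using assms by (intro krawtchouk_symmetry) auto
  \<comment> \<open>The expansion produces \<open>j\<close> as the argument; symmetry turns it back
    into the degree and supplies the factor \<open>m choose l\<close>.\<close>
  have inner: "real (m choose j) * krawtchouk m l (real j) =
      real (m choose l) * krawtchouk m j (real l)" if "l \<le> p" for l
    using assms that by (intro krawtchouk_symmetry) auto
  have "real (m choose j) * krawtchouk (2 * m) p (real (2 * j)) =
      (\<Sum>l | l \<le> p \<and> l mod 2 = p mod 2.
       2 ^ l * real ((m - l) choose ((p - l) div 2)) * (real (m choose j) * krawtchouk m l (real j)))"
    unfolding krawtchouk_even[OF assms(2,3)] by (simp add: sum_distrib_left mult_ac)
  also have "\<dots> = (\<Sum>l | l \<le> p \<and> l mod 2 = p mod 2.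
       2 ^ l * real ((m - l) choose ((p - l) div 2)) * real (m choose l) *
       krawtchouk m j (real l))"
    by (rule sum.cong) (simp_all add: inner)
  finally have sum_eq: "(\<Sum>l | l \<le> p \<and> l mod 2 = p mod 2.
       2 ^ l * real ((m - l) choose ((p - l) div 2)) * real (m choose l) *
       krawtchouk m j (real l)) = real (m choose j) * krawtchouk (2 * m) p (real (2 * j))" ..
  have "real (2 * m choose p) \<noteq> 0" "real (m choose j) \<noteq> 0"
    using assms by simp_all
  then show ?thesis
    unfolding sum_eq using outer by (simp add: field_simps)
qed

end
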